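(* Let $K\subset\mathbb{R}^3$ be a convex body with $C^2$-boundary and positive Gaussian curvature, and let $h_K\in C^2(\mathbb{S}^2)$ be its support function. Fix $\nu\in\mathbb{S}^2$. For each $\omega\in\mathbb{S}^2\setminus\{\pm\nu\}$, write $$\omega=\sin\alpha\,u(\theta)+\cos\alpha\,\nu,\qquad 0<\alpha<\pi,$$ where $u(\theta)\in\mathbb{S}^2\cap\nu^\perp$, and define an orthonormal basis $\{u^\perp,\tau\}$ of $T_\omega\mathbb{S}^2$ by $$u^\perp(\theta):=\frac{\partial u}{\partial\theta},\qquad \tau:=\sin\alpha\,\nu-\cos\alpha\,u(\theta).$$ Then the following statements are equivalent: (1) For every $\omega\in\mathbb{S}^2\setminus\{\pm\nu\}$, the vectors $u^\perp$ and $\tau$ are principal directions of $\partial K$ at $N^{-1}(\omega)$, where $N$ is the Gauss map of $\partial K$. (2) There exist a function $\varphi:[-1,1]\to\mathbb{R}$ and a vector $a\in\mathbb{R}^3$ such that $h_K(\omega)=\varphi(\omega\cdot\nu)+a\cdot\omega$ for all $\omega\in\mathbb{S}^2$. (3) Up to a translation, $K$ is a body of revolution about an axis parallel to $\nu$.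
   Context: The support function is $h_K(v)=\sup_{x\in K}x\cdot v$, here restricted to $\mathbb{S}^2$. Here $\nu^\perp=\{x\in\mathbb{R}^3:x\cdot\nu=0\}$, $T_\omega\mathbb{S}^2=\{v\in\mathbb{R}^3:v\cdot\omega=0\}$, and $u(\theta)=\cos\theta\,v_1+\sin\theta\,v_2$ for a fixed orthonormal basis $\{v_1,v_2\}$ of $\nu^\perp$. $N:\partial K\to\mathbb{S}^2$ is the outward unit normal (Gauss) map, and $T_{N^{-1}(\omega)}\partial K$ is identified with $T_\omega\mathbb{S}^2$; principal directions are eigenvectors of $dN$. A body of revolution about an axis is one invariant under all rotations about that axis. *)

theory Defs
  imports "HOL-Analysis.Analysis"
begin

definition C2_on ::
    "('a::real_normed_vector \<Rightarrow> 'b::real_normed_vector) \<Rightarrow> 'a set \<Rightarrow> bool"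
  where "C2_on f U \<longleftrightarrow>
    (\<exists>(f' :: 'a \<Rightarrow> 'a \<Rightarrow>\<^sub>L 'b) (f'' :: 'a \<Rightarrow> 'a \<Rightarrow>\<^sub>L 'a \<Rightarrow>\<^sub>L 'b).
      (\<forall>x\<in>U. (f has_derivative blinfun_apply (f' x)) (at x)) \<and>
      (\<forall>x\<in>U. (f' has_derivative blinfun_apply (f'' x)) (at x)) \<and>
      continuous_on U f'')"

(* Differentiability on a submanifold is understood through extensions to an open neighbourhood. *)
definition C2_on_sphere :: "(real ^ 3 \<Rightarrow> real) \<Rightarrow> bool"
  where "C2_on_sphere f \<longleftrightarrow>
    (\<exists>U F. open U \<and> sphere 0 1 \<subseteq> U \<and> C2_on F U \<and> (\<forall>x\<in>sphere 0 1. F x = f x))"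

definition convex_body :: "(real ^ 3) set \<Rightarrow> bool"
  where "convex_body K \<longleftrightarrow> convex K \<and> compact K \<and> interior K \<noteq> {}"

definition C2_boundary :: "(real ^ 3) set \<Rightarrow> bool"
  where "C2_boundary K \<longleftrightarrow>
    (\<forall>p\<in>frontier K. \<exists>U (\<rho> :: real ^ 3 \<Rightarrow> real).
      open U \<and> p \<in> U \<and> C2_on \<rho> U \<and>
      (\<forall>x\<in>U. frechet_derivative \<rho> (at x) \<noteq> (\<lambda>_. 0)) \<and>
      K \<inter> U = {x\<in>U. \<rho> x \<le> 0})"

definition support_function :: "(real ^ 3) set \<Rightarrow> real ^ 3 \<Rightarrow> real"
  where "support_function K v = (SUP x\<in>K. x \<bullet> v)"

(* The outward unit normal at a boundary point of a convex body; it is unique when the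
   boundary is C^2. Only the values on the frontier of K are meaningful. *)
definition gauss_map :: "(real ^ 3) set \<Rightarrow> real ^ 3 \<Rightarrow> real ^ 3"
  where "gauss_map K p = (THE n. norm n = 1 \<and> (\<forall>y\<in>K. (y - p) \<bullet> n \<le> 0))"

definition tangent_space :: "(real ^ 3) set \<Rightarrow> real ^ 3 \<Rightarrow> (real ^ 3) set"
  where "tangent_space K p = {v. v \<bullet> gauss_map K p = 0}"

(* The differential of the Gauss map is the derivative within the surface. A linear map D that
   is such a derivative is determined by the surface only on the tangent space, and the
   definitions below use it only there. *)
definition gauss_map_differential ::
    "(real ^ 3) set \<Rightarrow> real ^ 3 \<Rightarrow> (real ^ 3 \<Rightarrow> real ^ 3) \<Rightarrow> bool"
  where "gauss_map_differential K p D \<longleftrightarrow>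
    (gauss_map K has_derivative D) (at p within frontier K)"

(* k is the determinant of the differential on the tangent space, computed in an
   orthonormal basis {e1, e2} of it. *)
definition has_gaussian_curvature :: "(real ^ 3) set \<Rightarrow> real ^ 3 \<Rightarrow> real \<Rightarrow> bool"
  where "has_gaussian_curvature K p k \<longleftrightarrow>
    (\<exists>D e1 e2. gauss_map_differential K p D \<and>
      e1 \<in> tangent_space K p \<and> e2 \<in> tangent_space K p \<and>
      norm e1 = 1 \<and> norm e2 = 1 \<and> e1 \<bullet> e2 = 0 \<and>
      k = (D e1 \<bullet> e1) * (D e2 \<bullet> e2) - (D e1 \<bullet> e2) * (D e2 \<bullet> e1))"

definition principal_direction :: "(real ^ 3) set \<Rightarrow> real ^ 3 \<Rightarrow> real ^ 3 \<Rightarrow> bool"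
  where "principal_direction K p v \<longleftrightarrow>
    v \<in> tangent_space K p \<and> v \<noteq> 0 \<and>
    (\<exists>D \<kappa>. gauss_map_differential K p D \<and> D v = \<kappa> *\<^sub>R v)"

definition u :: "real ^ 3 \<Rightarrow> real ^ 3 \<Rightarrow> real \<Rightarrow> real ^ 3"
  where "u v1 v2 \<theta> = cos \<theta> *\<^sub>R v1 + sin \<theta> *\<^sub>R v2"

definition u_perp :: "real ^ 3 \<Rightarrow> real ^ 3 \<Rightarrow> real \<Rightarrow> real ^ 3"
  where "u_perp v1 v2 \<theta> = vector_derivative (u v1 v2) (at \<theta>)"

definition tau :: "real ^ 3 \<Rightarrow> real ^ 3 \<Rightarrow> real ^ 3 \<Rightarrow> real \<Rightarrow> real \<Rightarrow> real ^ 3"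
  where "tau \<nu> v1 v2 \<alpha> \<theta> = sin \<alpha> *\<^sub>R \<nu> - cos \<alpha> *\<^sub>R u v1 v2 \<theta>"

(* f is a rotation about the axis through p with direction \<nu> *)
definition rotation_about_axis ::
    "real ^ 3 \<Rightarrow> real ^ 3 \<Rightarrow> (real ^ 3 \<Rightarrow> real ^ 3) \<Rightarrow> bool"
  where "rotation_about_axis p \<nu> f \<longleftrightarrow>
    (\<exists>Q :: real ^ 3 ^ 3. rotation_matrix Q \<and> Q *v \<nu> = \<nu> \<and> f = (\<lambda>x. p + Q *v (x - p)))"

definition body_of_revolution :: "(real ^ 3) set \<Rightarrow> real ^ 3 \<Rightarrow> real ^ 3 \<Rightarrow> bool"
  where "body_of_revolution K p \<nu> \<longleftrightarrow>
    convex_body K \<and> (\<forall>f. rotation_about_axis p \<nu> f \<longrightarrow> f ` K = K)"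

end

theory Submission
  imports Defs
begin

text \<open>Let \<open>P \<omega> = N\<^sup>-\<^sup>1(\<omega>)\<close> be the support point of \<open>K\<close> at \<open>\<omega>\<close>; its derivative \<open>P' \<omega>\<close> inverts
  \<open>dN\<close> on the tangent plane, so both have the same eigenvectors there.
  If \<open>\<tau>\<close> is always principal, then \<open>P' \<tau> \<bullet> u\<^sup>\<bottom> = 0\<close> says that \<open>P \<bullet> u\<^sup>\<bottom>(\<theta>)\<close> is constant along the
  meridian \<open>\<theta>\<close>, hence equal to its value \<open>a \<bullet> u\<^sup>\<bottom>(\<theta>)\<close> at the pole, where \<open>a = P \<nu>\<close>. Then
  \<open>\<partial>\<^sub>\<theta> (h - a \<bullet> \<omega>) = sin \<alpha> (P - a) \<bullet> u\<^sup>\<bottom> = 0\<close>, so \<open>h - a \<bullet> \<omega>\<close> depends on the latitude only.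
  Conversely, such an \<open>h\<close> makes \<open>K - a\<close> invariant under every orthogonal map fixing \<open>\<nu>\<close>: the rotations
  give the body of revolution, and the reflections in planes through \<open>\<nu>\<close> the principal directions.\<close>

section \<open>Support points\<close>

lemma inner_le_support_function:
  assumes "convex_body K" "x \<in> K"
  shows "x \<bullet> v \<le> support_function K v"
proof -
  have "compact ((\<lambda>x. x \<bullet> v) ` K)"
    using assms by (intro compact_continuous_image continuous_intros) (auto simp: convex_body_def)
  then have "bdd_above ((\<lambda>x. x \<bullet> v) ` K)"
    by (simp add: bounded_imp_bdd_above compact_imp_bounded)
  then show ?thesis
    unfolding support_function_def using assms by (intro cSUP_upper) auto
qed

lemma support_function_attained:
  assumes "convex_body K"
  obtains x where "x \<in> K" "x \<bullet> v = support_function K v"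
proof -
  have K: "compact K" "K \<noteq> {}" using assms by (auto simp: convex_body_def)
  obtain x where x: "x \<in> K" "\<forall>y\<in>K. y \<bullet> v \<le> x \<bullet> v"
    using continuous_attains_sup[OF K continuous_on_inner[OF continuous_on_id continuous_on_const]]
    by blast
  moreover have "support_function K v \<le> x \<bullet> v"
    unfolding support_function_def using x K by (intro cSUP_least) auto
  ultimately show thesis
    using that inner_le_support_function[OF assms] by (metis order_antisym)
qed

text \<open>A point outside \<open>K\<close> is strictly separated from \<open>K\<close> by a plane,
  and the unit normal of that plane gives a violated inequality. This lets membership be tested on
  \<open>support_function\<close> alone, which is how symmetries of the support function become
  symmetries of the body.\<close>

lemma mem_convex_body_iff:
  assumes "convex_body K"
  shows "x \<in> K \<longleftrightarrow> (\<forall>\<omega>\<in>sphere 0 1. x \<bullet> \<omega> \<le> support_function K \<omega>)"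
proof
  assume R: "\<forall>\<omega>\<in>sphere 0 1. x \<bullet> \<omega> \<le> support_function K \<omega>"
  show "x \<in> K"
  proof (rule ccontr)
    assume "x \<notin> K"
    moreover have "convex K" "closed K" "K \<noteq> {}"
      using assms by (auto simp: convex_body_def compact_imp_closed)
    ultimately obtain a b where ab: "a \<bullet> x < b" "\<forall>y\<in>K. b < a \<bullet> y"
      using separating_hyperplane_closed_point by blast
    with \<open>K \<noteq> {}\<close> have "a \<noteq> 0" by fastforce
    define \<omega> where "\<omega> = - sgn a"
    have \<omega>: "\<omega> \<in> sphere 0 1" using \<open>a \<noteq> 0\<close> by (simp add: \<omega>_def norm_sgn)
    obtain y where y: "y \<in> K" "y \<bullet> \<omega> = support_function K \<omega>"
      using support_function_attained[OF assms] .
    have "a \<bullet> x < a \<bullet> y" using ab y by force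
    then have "y \<bullet> \<omega> < x \<bullet> \<omega>"
      using \<open>a \<noteq> 0\<close> by (simp add: \<omega>_def sgn_div_norm inner_commute divide_simps)
    with R \<omega> y show False by force
  qed
qed (use assms inner_le_support_function in blast)

lemma great_circle_mem_sphere:
  assumes "norm a = 1" "norm b = 1" "a \<bullet> b = 0"
  shows "norm (cos t *\<^sub>R a + sin t *\<^sub>R b) = 1"
proof -
  have "a \<bullet> a = 1" "b \<bullet> b = 1" "b \<bullet> a = 0" using assms by (auto simp: norm_eq_1 inner_commute)
  then have "(norm (cos t *\<^sub>R a + sin t *\<^sub>R b))\<^sup>2 = (cos t)\<^sup>2 + (sin t)\<^sup>2"
    unfolding power2_norm_eq_inner using assms
    by (simp add: inner_add power2_eq_square)
  then have "(norm (cos t *\<^sub>R a + sin t *\<^sub>R b))\<^sup>2 = 1\<^sup>2" by simp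
  then show ?thesis by (rule power2_eq_imp_eq) auto
qed

text \<open>At \<open>t = 0\<close> the curve passes through \<open>a\<close> with velocity
  \<open>b\<close>, so great circles serve below as test curves for derivatives in tangent
  directions.\<close>

lemma great_circle_has_vector_derivative:
  "((\<lambda>t. cos t *\<^sub>R a + sin t *\<^sub>R b) has_vector_derivative (- sin t *\<^sub>R a + cos t *\<^sub>R b)) (at t)"
  by (auto intro!: derivative_eq_intros simp: has_real_derivative_iff_has_vector_derivative[symmetric])

text \<open>A support point at \<open>\<omega>\<close> is \<open>\<nabla>\<^sub>S h(\<omega>) + h(\<omega>) \<omega>\<close>, with the gradient taken on the sphere;
  hence it is unique and one derivative less smooth than \<open>h\<close>.\<close>

lemma support_point_map_exists:
  assumes K: "convex_body K" and C2: "C2_on_sphere (support_function K)"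
  obtains P P' where
    "\<And>\<omega>. norm \<omega> = 1 \<Longrightarrow> (P has_derivative P' \<omega>) (at \<omega>)"
    "\<And>\<omega> x. norm \<omega> = 1 \<Longrightarrow> x \<in> K \<and> x \<bullet> \<omega> = support_function K \<omega> \<longleftrightarrow> x = P \<omega>"
proof -
  obtain U F F' F'' where U: "open U" "sphere 0 1 \<subseteq> U"
    and Fh': "\<forall>x\<in>sphere 0 1. F x = support_function K x"
    and F: "\<forall>x\<in>U. (F has_derivative blinfun_apply (F' x)) (at x)"
    and F': "\<forall>x\<in>U. (F' has_derivative blinfun_apply (F'' x)) (at x)"
    using C2 unfolding C2_on_sphere_def C2_on_def by blast
  have Fh: "F x = support_function K x" if "norm x = 1" for x
    using Fh' that by auto
  \<comment> \<open>This is \<nabla>h + h \<omega> in coordinates: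
    \<open>b - (b \<bullet> \<omega>) *\<^sub>R \<omega>\<close> is the tangential part of
    \<open>b\<close>, and on tangent vectors the derivative of the extension \<open>F\<close>
    depends on h alone. Using \<open>F\<close> makes the formula meaningful off the sphere too, so
    \<open>P\<close> can be differentiated in the ambient space.\<close>
  define P :: "real^3 \<Rightarrow> real^3" where
    "P \<omega> = (\<Sum>b\<in>Basis. (F' \<omega> (b - (b \<bullet> \<omega>) *\<^sub>R \<omega>) + F \<omega> * (b \<bullet> \<omega>)) *\<^sub>R b)" for \<omega>
  have diff: "P differentiable (at \<omega>)" if "norm \<omega> = 1" for \<omega>
  proof -
    have "\<omega> \<in> U" using that U by auto
    then have F\<omega>: "(F has_derivative F' \<omega>) (at \<omega>)" "(F' has_derivative F'' \<omega>) (at \<omega>)"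
      using F F' by auto
    have "((\<lambda>x. b - (b \<bullet> x) *\<^sub>R x) has_derivative (\<lambda>h. - ((b \<bullet> \<omega>) *\<^sub>R h + (b \<bullet> h) *\<^sub>R \<omega>))) (at \<omega>)" for b
      by (auto intro!: derivative_eq_intros)
    from bounded_bilinear.FDERIV[OF bounded_bilinear_blinfun_apply F\<omega>(2) this]
    have "(\<lambda>x. F' x (b - (b \<bullet> x) *\<^sub>R x)) differentiable (at \<omega>)" for b
      unfolding differentiable_def by blast
    moreover have "(\<lambda>x. F x * (b \<bullet> x)) differentiable (at \<omega>)" for b
      using F\<omega>(1) unfolding differentiable_def
      by (intro exI) (rule derivative_intros | assumption)+
    ultimately have "(\<lambda>x. P x) differentiable (at \<omega>)"
      unfolding P_def by (intro differentiable_sum differentiable_scaleR differentiable_add) auto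
    then show ?thesis by simp
  qed
  have unique: "x = P \<omega>" if \<omega>: "norm \<omega> = 1" and x: "x \<in> K" "x \<bullet> \<omega> = support_function K \<omega>" for x \<omega>
  proof -
    have unit: "x \<bullet> w = F' \<omega> w" if w: "norm w = 1" "\<omega> \<bullet> w = 0" for w
    proof -
      define c where "c = (\<lambda>t. cos t *\<^sub>R \<omega> + sin t *\<^sub>R w)"
      have c: "norm (c t) = 1" for t using great_circle_mem_sphere \<omega> w by (simp add: c_def)
      have c0: "c 0 = \<omega>" by (simp add: c_def)
      have dc: "(c has_vector_derivative w) (at 0)"
        using great_circle_has_vector_derivative[of \<omega> w 0] by (simp add: c_def)
      have "\<omega> \<in> U" using \<omega> U by auto
      then have "((F \<circ> c) has_vector_derivative F' \<omega> w) (at 0)"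
        using vector_derivative_diff_chain_within[OF dc, of F "F' \<omega>"] F c0 has_derivative_at_withinI
        by metis
      then have deriv: "((\<lambda>t. F (c t) - x \<bullet> c t) has_real_derivative (F' \<omega> w - x \<bullet> w)) (at 0)"
        unfolding has_real_derivative_iff_has_vector_derivative o_def
        by (intro derivative_intros bounded_linear.has_vector_derivative[OF bounded_linear_inner_right dc])
      \<comment> \<open>On the sphere \<open>F\<close> is the support function, which dominates the
        linear functional given by \<open>x\<close> and equals it at \<omega>. The difference is
        therefore minimal at \<open>t = 0\<close>, and its derivative vanishes there.\<close>
      have "F (c 0) - x \<bullet> c 0 \<le> F (c t) - x \<bullet> c t" for t
        using Fh[OF c] inner_le_support_function[OF K x(1), of "c t"] x(2) by (simp add: c0 Fh \<omega>)
      then have "F' \<omega> w - x \<bullet> w = 0"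
        using DERIV_local_min[OF deriv zero_less_one] by blast
      then show ?thesis by simp
    qed
    have tangent: "x \<bullet> w = F' \<omega> w" if w: "\<omega> \<bullet> w = 0" for w
    proof (cases "w = 0")
      case False
      then have "x \<bullet> sgn w = F' \<omega> (sgn w)"
        using w by (intro unit) (auto simp: norm_sgn sgn_div_norm)
      then have "norm w * (x \<bullet> sgn w) = norm w * F' \<omega> (sgn w)" by simp
      then show ?thesis
        using False by (simp add: sgn_div_norm blinfun.scaleR_right field_simps)
    qed simp
    have "\<omega> \<bullet> \<omega> = 1" using \<omega> by (simp add: norm_eq_1)
    have "x \<bullet> b = F' \<omega> (b - (b \<bullet> \<omega>) *\<^sub>R \<omega>) + F \<omega> * (b \<bullet> \<omega>)" for b
    proof -
      have "x \<bullet> (b - (b \<bullet> \<omega>) *\<^sub>R \<omega>) = F' \<omega> (b - (b \<bullet> \<omega>) *\<^sub>R \<omega>)"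
        by (rule tangent) (simp add: inner_diff \<open>\<omega> \<bullet> \<omega> = 1\<close> inner_commute)
      then show ?thesis using x Fh[OF \<omega>] by (simp add: inner_diff algebra_simps)
    qed
    then show ?thesis
      unfolding P_def using euclidean_representation[of x] by simp
  qed
  show thesis
  proof (rule that)
    show "(P has_derivative frechet_derivative P (at \<omega>)) (at \<omega>)" if "norm \<omega> = 1" for \<omega>
      using diff[OF that] frechet_derivative_works by blast
    show "x \<in> K \<and> x \<bullet> \<omega> = support_function K \<omega> \<longleftrightarrow> x = P \<omega>" if "norm \<omega> = 1" for \<omega> x
      using unique[OF that] support_function_attained[OF K, of \<omega>] by metis
  qed
qed

section \<open>The Gauss map\<close>

text \<open>Let \<open>g\<close> be the gradient at \<open>p\<close> of a local defining function.
  Every \<open>v\<close> with \<open>g \<bullet> v < 0\<close> points into \<open>K\<close>, so an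
  outer normal has non-positive inner product with this whole open half-space; that forces it to be
  a positive multiple of \<open>g\<close>.\<close>

lemma outer_normal_direction:
  assumes K: "convex_body K" and C2: "C2_boundary K" and p: "p \<in> frontier K"
  obtains g where "\<And>n. norm n = 1 \<Longrightarrow> \<forall>y\<in>K. (y - p) \<bullet> n \<le> 0 \<Longrightarrow> n = sgn g"
proof -
  have "closed K" using K by (simp add: convex_body_def compact_imp_closed)
  obtain U and \<rho> :: "real^3 \<Rightarrow> real" where U: "open U" "p \<in> U" and \<rho>: "C2_on \<rho> U"
    and nz: "\<forall>x\<in>U. frechet_derivative \<rho> (at x) \<noteq> (\<lambda>_. 0)" and KU: "K \<inter> U = {x\<in>U. \<rho> x \<le> 0}"
    using C2 p unfolding C2_boundary_def by blast
  obtain \<rho>' where \<rho>': "\<And>x. x \<in> U \<Longrightarrow> (\<rho> has_derivative blinfun_apply (\<rho>' x)) (at x)"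
    using \<rho> unfolding C2_on_def by blast
  define g :: "real^3" where "g = (\<Sum>b\<in>Basis. \<rho>' p b *\<^sub>R b)"
  have g: "\<rho>' p v = g \<bullet> v" for v
  proof -
    have "\<rho>' p v = \<rho>' p (\<Sum>b\<in>Basis. (v \<bullet> b) *\<^sub>R b)" by (simp add: euclidean_representation)
    also have "\<dots> = (\<Sum>b\<in>Basis. (v \<bullet> b) * \<rho>' p b)" by (simp add: blinfun.sum_right blinfun.scaleR_right)
    also have "\<dots> = g \<bullet> v" by (simp add: g_def inner_sum_right inner_commute[of _ v] mult.commute)
    finally show ?thesis .
  qed
  have "g \<noteq> 0"
  proof
    assume "g = 0"
    then have "blinfun_apply (\<rho>' p) = (\<lambda>_. 0)" using g by auto
    then show False using nz U frechet_derivative_at[OF \<rho>'[OF U(2)]] by auto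
  qed
  have "p \<in> K" using p \<open>closed K\<close> frontier_subset_closed by blast
  have cont: "continuous_on U \<rho>"
    using \<rho>' U by (intro continuous_at_imp_continuous_on) (auto intro: has_derivative_continuous)
  have \<rho>p: "\<rho> p = 0"
  proof (rule ccontr)
    assume "\<rho> p \<noteq> 0"
    moreover have "\<rho> p \<le> 0" using KU U \<open>p \<in> K\<close> by blast
    ultimately have "p \<in> U \<inter> \<rho> -` {..<0}" using U by simp
    moreover have "open (U \<inter> \<rho> -` {..<0})"
      using continuous_open_preimage[OF cont U(1)] by auto
    moreover have "U \<inter> \<rho> -` {..<0} \<subseteq> K" using KU by force
    ultimately have "p \<in> interior K" by (meson interiorI)
    then show False using p by (simp add: frontier_def)
  qed
  have half: "v \<bullet> n \<le> 0" if n: "\<forall>y\<in>K. (y - p) \<bullet> n \<le> 0" and v: "g \<bullet> v < 0" for n v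
  proof -
    have d: "((\<lambda>t. p + t *\<^sub>R v) has_vector_derivative v) (at 0)"
      by (auto intro!: derivative_eq_intros)
    have "((\<rho> \<circ> (\<lambda>t. p + t *\<^sub>R v)) has_vector_derivative \<rho>' p v) (at 0)"
      using vector_derivative_diff_chain_within[OF d, of \<rho> "\<rho>' p"] \<rho>'[OF U(2)]
      by (auto intro: has_derivative_at_withinI)
    then have "((\<lambda>t. \<rho> (p + t *\<^sub>R v)) has_real_derivative (g \<bullet> v)) (at 0)"
      by (simp add: has_real_derivative_iff_has_vector_derivative o_def g)
    from DERIV_neg_dec_right[OF this v] obtain d where d: "d > 0"
      "\<And>t. t > 0 \<Longrightarrow> t < d \<Longrightarrow> \<rho> (p + t *\<^sub>R v) < 0" using \<rho>p by auto
    have "open ((\<lambda>t. p + t *\<^sub>R v) -` U)"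
      by (intro open_vimage U continuous_intros)
    moreover have "0 \<in> (\<lambda>t. p + t *\<^sub>R v) -` U" using U by simp
    ultimately obtain e where e: "e > 0" "ball 0 e \<subseteq> (\<lambda>t. p + t *\<^sub>R v) -` U"
      using open_contains_ball by blast
    define t where "t = min d e / 2"
    have t: "0 < t" "t < d" "t < e" using d e by (auto simp: t_def)
    then have "t \<in> ball 0 e" by simp
    then have "p + t *\<^sub>R v \<in> K" using d(2)[OF t(1,2)] e KU by force
    then have "(p + t *\<^sub>R v - p) \<bullet> n \<le> 0" using n by blast
    then have "t * (v \<bullet> n) \<le> 0" by simp
    then show ?thesis using t by (simp add: mult_le_0_iff)
  qed
  have "n = sgn g" if n: "norm n = 1" "\<forall>y\<in>K. (y - p) \<bullet> n \<le> 0" for n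
  proof -
    \<comment> \<open>Test \<open>half\<close> with \<open>n - s g\<close>, where \<open>s\<close> is just above the value for which it is tangential.\<close>
    define c where "c = (n \<bullet> g) / (g \<bullet> g)"
    have gg: "g \<bullet> g > 0" using \<open>g \<noteq> 0\<close> by simp
    have le: "n \<bullet> n - c * (n \<bullet> g) \<le> e * (n \<bullet> g)" if "e > 0" for e
    proof -
      have "g \<bullet> (n - (c + e) *\<^sub>R g) = - e * (g \<bullet> g)"
        using gg by (simp add: c_def inner_diff inner_commute field_simps)
      then have "g \<bullet> (n - (c + e) *\<^sub>R g) < 0" using gg that by simp
      from half[OF n(2) this] show ?thesis
        by (simp add: inner_diff algebra_simps inner_commute)
    qed
    \<comment> \<open>The slack in \<open>le\<close> is rescaled so that its contribution is at most
      \<open>e\<close>, and then \<open>e\<close> tends to 0.\<close>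
    have "n \<bullet> n - c * (n \<bullet> g) \<le> 0 + e" if "e > 0" for e
    proof -
      have "e / (\<bar>n \<bullet> g\<bar> + 1) * (n \<bullet> g) \<le> e / (\<bar>n \<bullet> g\<bar> + 1) * (\<bar>n \<bullet> g\<bar> + 1)"
        using that by (intro mult_left_mono) auto
      also have "\<dots> = e" by (auto simp: divide_simps)
      finally show ?thesis using le[of "e / (\<bar>n \<bullet> g\<bar> + 1)"] that by force
    qed
    then have "n \<bullet> n - c * (n \<bullet> g) \<le> 0" by (rule field_le_epsilon)
    \<comment> \<open>The bounded quantity is the squared length of the component of
      \<open>n\<close> orthogonal to \<open>g\<close>, so that component vanishes.\<close>
    moreover have "(n - c *\<^sub>R g) \<bullet> (n - c *\<^sub>R g) = n \<bullet> n - c * (n \<bullet> g)"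
      using gg by (simp add: inner_diff c_def inner_commute field_simps)
    ultimately have "n - c *\<^sub>R g = 0" by (metis inner_ge_zero inner_eq_zero_iff order_antisym)
    then have nc: "n = c *\<^sub>R g" by simp
    \<comment> \<open>With slack 1, \<open>le\<close> bounds a squared length by
      \<open>n \<bullet> g\<close>, which settles the sign.\<close>
    have "n \<bullet> g \<ge> 0"
      using le[of 1] \<open>(n - c *\<^sub>R g) \<bullet> (n - c *\<^sub>R g) = n \<bullet> n - c * (n \<bullet> g)\<close>
        inner_ge_zero[of "n - c *\<^sub>R g"] by simp
    then have "c \<ge> 0" using gg by (simp add: c_def)
    then have "sgn n = sgn g"
      using n nc by (metis sgn_scaleR sgn_pos scaleR_one less_eq_real_def norm_zero scaleR_zero_left zero_neq_one)
    then show ?thesis using n by (simp add: sgn_div_norm)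
  qed
  then show thesis using that by blast
qed

lemma outer_normal_exists:
  assumes K: "convex_body K" and p: "p \<in> frontier K"
  obtains n where "norm n = 1" "\<forall>y\<in>K. (y - p) \<bullet> n \<le> 0"
proof -
  have "convex K" "interior K \<noteq> {}" using K by (auto simp: convex_body_def)
  moreover have "p \<in> closure K" "p \<notin> rel_interior K"
    using p \<open>interior K \<noteq> {}\<close> by (auto simp: frontier_def rel_interior_nonempty_interior)
  ultimately obtain a where a: "a \<noteq> 0" "\<And>y. y \<in> closure K \<Longrightarrow> a \<bullet> p \<le> a \<bullet> y"
    using supporting_hyperplane_relative_frontier by metis
  show thesis
  proof
    show "norm (- sgn a) = 1" using a by (simp add: norm_sgn)
    show "\<forall>y\<in>K. (y - p) \<bullet> - sgn a \<le> 0"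
      using a closure_subset by (fastforce simp: sgn_div_norm inner_diff inner_commute divide_simps)
  qed
qed

text \<open>All candidates for the \<open>THE\<close> in \<open>gauss_map\<close> equal the same
  normalized gradient, so any one of them is its value.\<close>

lemma gauss_map_eq:
  assumes "convex_body K" "C2_boundary K" "p \<in> frontier K" "norm n = 1" "\<forall>y\<in>K. (y - p) \<bullet> n \<le> 0"
  shows "gauss_map K p = n"
  unfolding gauss_map_def using assms outer_normal_direction[OF assms(1-3)]
  by (intro the_equality) metis+

text \<open>From an interior point one could move a little in direction \<omega> inside
  \<open>K\<close> and exceed the maximum of the linear functional.\<close>

lemma support_point_in_frontier:
  assumes K: "convex_body K" and x: "x \<in> K" "x \<bullet> \<omega> = support_function K \<omega>" and \<omega>: "norm \<omega> = 1"
  shows "x \<in> frontier K"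
proof -
  have "x \<notin> interior K"
  proof
    assume "x \<in> interior K"
    then obtain e where e: "e > 0" "cball x e \<subseteq> K" using mem_interior_cball by blast
    then have "x + e *\<^sub>R \<omega> \<in> K" using \<omega> by (auto simp: dist_norm)
    from inner_le_support_function[OF K this, of \<omega>] show False
      using x \<omega> e by (simp add: inner_add_left norm_eq_1)
  qed
  then show ?thesis using x closure_subset by (auto simp: frontier_def)
qed

lemma gauss_map_support_point:
  assumes "convex_body K" "C2_boundary K" "x \<in> K" "x \<bullet> \<omega> = support_function K \<omega>" "norm \<omega> = 1"
  shows "gauss_map K x = \<omega>"
  using assms by (intro gauss_map_eq support_point_in_frontier)
    (auto simp: inner_diff_left inner_le_support_function)

text \<open>An outer normal exists at \<open>p\<close> and must be the Gauss image, so
  \<open>p\<close> maximizes the corresponding functional. Together with uniqueness of support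
  points this makes the Gauss map injective.\<close>

lemma support_point_of_gauss_map:
  assumes K: "convex_body K" and C2: "C2_boundary K" and p: "p \<in> frontier K"
    and \<omega>: "gauss_map K p = \<omega>"
  shows "p \<in> K" "p \<bullet> \<omega> = support_function K \<omega>"
proof -
  show pK: "p \<in> K"
    using K p by (metis convex_body_def compact_imp_closed frontier_subset_closed subsetD)
  obtain n where n: "norm n = 1" "\<forall>y\<in>K. (y - p) \<bullet> n \<le> 0" using outer_normal_exists[OF K p] .
  then have "n = \<omega>" using gauss_map_eq[OF K C2 p] \<omega> by blast
  then show "p \<bullet> \<omega> = support_function K \<omega>"
    using n pK K support_function_attained[OF K, of \<omega>] inner_le_support_function[OF K pK, of \<omega>]
    by (metis diff_le_0_iff_le inner_diff_left order_antisym)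
qed

section \<open>The inverse Gauss map and its derivative\<close>

locale support_points =
  fixes K :: "(real^3) set" and P :: "real^3 \<Rightarrow> real^3" and P' :: "real^3 \<Rightarrow> real^3 \<Rightarrow> real^3"
  assumes body: "convex_body K" and boundary: "C2_boundary K"
    and P_deriv: "norm \<omega> = 1 \<Longrightarrow> (P has_derivative P' \<omega>) (at \<omega>)"
    and P_iff: "norm \<omega> = 1 \<Longrightarrow> x \<in> K \<and> x \<bullet> \<omega> = support_function K \<omega> \<longleftrightarrow> x = P \<omega>"
begin

lemma P_mem: "norm \<omega> = 1 \<Longrightarrow> P \<omega> \<in> K"
  and P_inner: "norm \<omega> = 1 \<Longrightarrow> P \<omega> \<bullet> \<omega> = support_function K \<omega>"
  using P_iff by blast+

lemma linear_P': "norm \<omega> = 1 \<Longrightarrow> linear (P' \<omega>)"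
  using P_deriv has_derivative_linear by blast

lemma P_along_curve:
  assumes "(c has_vector_derivative w) (at t)" "norm (c t) = 1"
  shows "((\<lambda>t. P (c t)) has_vector_derivative P' (c t) w) (at t)"
  using vector_derivative_diff_chain_within[OF assms(1) has_derivative_at_withinI[OF P_deriv[OF assms(2)]]]
  by (simp add: o_def)

lemma P_along_great_circle:
  assumes "norm \<omega> = 1" "norm w = 1" "\<omega> \<bullet> w = 0"
  shows "((\<lambda>t. P (cos t *\<^sub>R \<omega> + sin t *\<^sub>R w)) has_vector_derivative P' \<omega> w) (at 0)"
    and "((\<lambda>t. P (cos t *\<^sub>R \<omega> + sin t *\<^sub>R w) \<bullet> z) has_real_derivative P' \<omega> w \<bullet> z) (at 0)"
proof -
  show dP: "((\<lambda>t. P (cos t *\<^sub>R \<omega> + sin t *\<^sub>R w)) has_vector_derivative P' \<omega> w) (at 0)"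
    using P_along_curve[OF great_circle_has_vector_derivative[of \<omega> w 0]] assms by simp
  show "((\<lambda>t. P (cos t *\<^sub>R \<omega> + sin t *\<^sub>R w) \<bullet> z) has_real_derivative P' \<omega> w \<bullet> z) (at 0)"
    unfolding has_real_derivative_iff_has_vector_derivative
    by (rule bounded_linear.has_vector_derivative[OF bounded_linear_inner_left dP])
qed

text \<open>Along a great circle through \<omega>, the function
  \<open>P (c t) \<bullet> \<omega>\<close> is at most the support value at \<omega>, which it
  attains at \<open>t = 0\<close>. Its derivative at this maximum is zero.\<close>

lemma P'_tangent:
  assumes \<omega>: "norm \<omega> = 1" and w: "\<omega> \<bullet> w = 0"
  shows "P' \<omega> w \<bullet> \<omega> = 0"
proof -
  have unit: "P' \<omega> w \<bullet> \<omega> = 0" if w: "norm w = 1" "\<omega> \<bullet> w = 0" for w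
  proof -
    define c where "c = (\<lambda>t. cos t *\<^sub>R \<omega> + sin t *\<^sub>R w)"
    have c: "norm (c t) = 1" for t using great_circle_mem_sphere \<omega> w by (simp add: c_def)
    have c0: "c 0 = \<omega>" by (simp add: c_def)
    have deriv: "((\<lambda>t. P (c t) \<bullet> \<omega>) has_real_derivative P' \<omega> w \<bullet> \<omega>) (at 0)"
      unfolding c_def using P_along_great_circle(2) \<omega> w by blast
    have "P (c t) \<bullet> \<omega> \<le> P (c 0) \<bullet> \<omega>" for t
      using inner_le_support_function[OF body P_mem[OF c]] P_inner \<omega> c0 by simp
    then show ?thesis using DERIV_local_max[OF deriv zero_less_one] by blast
  qed
  show ?thesis
  proof (cases "w = 0")
    case False
    then have "P' \<omega> (sgn w) \<bullet> \<omega> = 0"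
      using w by (intro unit) (auto simp: norm_sgn sgn_div_norm)
    then show ?thesis
      using False linear_P'[OF \<omega>] by (simp add: sgn_div_norm linear_cmul)
  qed (simp add: linear_0 linear_P' \<omega>)
qed

text \<open>Differentiating \<open>P (c s) \<bullet> c s\<close> gives two terms, and
  \<open>P'_tangent\<close> removes the one containing \<open>P'\<close>. In effect \<open>P\<close>
  is the gradient of the support function.\<close>

lemma support_function_along_curve:
  assumes c: "(c has_vector_derivative w) (at t)" "\<And>s. norm (c s) = 1" and w: "c t \<bullet> w = 0"
  shows "((\<lambda>s. support_function K (c s)) has_real_derivative P (c t) \<bullet> w) (at t)"
proof -
  have "((\<lambda>s. P (c s) \<bullet> c s) has_vector_derivative P (c t) \<bullet> w + P' (c t) w \<bullet> c t) (at t)"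
    by (rule bounded_bilinear.has_vector_derivative[OF bounded_bilinear_inner P_along_curve[OF c] c(1)])
  then show ?thesis
    using P'_tangent[OF c(2) w] P_inner[OF c(2)]
    by (simp add: has_real_derivative_iff_has_vector_derivative)
qed

lemma gauss_map_P: "norm \<omega> = 1 \<Longrightarrow> gauss_map K (P \<omega>) = \<omega>"
  using gauss_map_support_point[OF body boundary] P_mem P_inner by blast

lemma P_frontier: "norm \<omega> = 1 \<Longrightarrow> P \<omega> \<in> frontier K"
  using support_point_in_frontier[OF body] P_mem P_inner by blast

text \<open>Whatever preimage \<open>inv_into\<close> selects is a support point at \<omega>, and
  there is just one.\<close>

lemma inv_gauss_map:
  assumes \<omega>: "norm \<omega> = 1"
  shows "inv_into (frontier K) (gauss_map K) \<omega> = P \<omega>"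
proof -
  have "\<omega> \<in> gauss_map K ` frontier K"
    using gauss_map_P[OF \<omega>] P_frontier[OF \<omega>] by (metis imageI)
  then show ?thesis
    using support_point_of_gauss_map[OF body boundary] P_iff[OF \<omega>]
    by (metis f_inv_into_f inv_into_into)
qed

text \<open>Chain rule applied to \<open>gauss_map K (P (c t)) = c t\<close>. The curve
  \<open>P (c t)\<close> stays in the frontier, as it must, since \<open>D\<close> is a derivative
  within the frontier.\<close>

lemma gauss_map_differential_P':
  assumes D: "gauss_map_differential K (P \<omega>) D" and \<omega>: "norm \<omega> = 1" and w: "\<omega> \<bullet> w = 0"
  shows "D (P' \<omega> w) = w"
proof -
  have linD: "linear D"
    using D unfolding gauss_map_differential_def by (rule has_derivative_linear)
  have unit: "D (P' \<omega> w) = w" if w: "norm w = 1" "\<omega> \<bullet> w = 0" for w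
  proof -
    define c where "c = (\<lambda>t. cos t *\<^sub>R \<omega> + sin t *\<^sub>R w)"
    have c: "norm (c t) = 1" for t using great_circle_mem_sphere \<omega> w by (simp add: c_def)
    have c0: "c 0 = \<omega>" by (simp add: c_def)
    have dc: "(c has_vector_derivative w) (at 0)"
      using great_circle_has_vector_derivative[of \<omega> w 0] by (simp add: c_def)
    have dP: "((\<lambda>t. P (c t)) has_vector_derivative P' \<omega> w) (at 0)"
      unfolding c_def using P_along_great_circle(1) \<omega> w by blast
    have "(gauss_map K has_derivative D) (at (P (c 0)) within range (\<lambda>t. P (c t)))"
      using D c c0 P_frontier unfolding gauss_map_differential_def
      by (auto intro: has_derivative_subset)
    from vector_derivative_diff_chain_within[OF dP this]
    have "(c has_vector_derivative D (P' \<omega> w)) (at 0)"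
      by (simp add: o_def gauss_map_P c)
    then show ?thesis using dc vector_derivative_unique_at by blast
  qed
  show ?thesis
  proof (cases "w = 0")
    case False
    then have "D (P' \<omega> (sgn w)) = sgn w"
      using w by (intro unit) (auto simp: norm_sgn sgn_div_norm)
    then show ?thesis
      using False linear_P'[OF \<omega>] linD by (simp add: sgn_div_norm linear_cmul)
  qed (simp add: linear_0 linear_P' \<omega> linD)
qed

text \<open>On the tangent plane \<open>D\<close> is a left inverse of \<open>P' \<omega>\<close>,
  which makes \<open>P' \<omega>\<close> injective there and, by finite dimension, bijective.
  Inverse maps have the same eigenvectors, with reciprocal eigenvalues.\<close>

lemma principal_direction_iff:
  assumes D: "gauss_map_differential K (P \<omega>) D" and \<omega>: "norm \<omega> = 1"
  shows "principal_direction K (P \<omega>) v \<longleftrightarrow> \<omega> \<bullet> v = 0 \<and> v \<noteq> 0 \<and> (\<exists>r. P' \<omega> v = r *\<^sub>R v)"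
proof -
  have T: "tangent_space K (P \<omega>) = {v. \<omega> \<bullet> v = 0}"
    by (simp add: tangent_space_def gauss_map_P \<omega> inner_commute)
  have "\<exists>r. P' \<omega> v = r *\<^sub>R v"
    if v: "\<omega> \<bullet> v = 0" "v \<noteq> 0" and E: "gauss_map_differential K (P \<omega>) E" "E v = k *\<^sub>R v" for E k
  proof -
    \<comment> \<open>\<open>P' \<omega>\<close> maps the tangent plane onto itself; \<open>H\<close> extends it by the identity on the normal line.\<close>
    define H where "H w = P' \<omega> (w - (\<omega> \<bullet> w) *\<^sub>R \<omega>) + (\<omega> \<bullet> w) *\<^sub>R \<omega>" for w
    have \<omega>\<omega>: "\<omega> \<bullet> \<omega> = 1" using \<omega> by (simp add: norm_eq_1)
    then have tan: "\<omega> \<bullet> (w - (\<omega> \<bullet> w) *\<^sub>R \<omega>) = 0" for w by (simp add: inner_diff_right)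
    have H\<omega>: "\<omega> \<bullet> H w = \<omega> \<bullet> w" for w
      using P'_tangent[OF \<omega> tan, of w] \<omega>\<omega>
      by (simp add: H_def inner_add_right inner_commute[of \<omega> "P' \<omega> _"])
    have "linear H"
      unfolding H_def using linear_P'[OF \<omega>]
      by (intro linearI) (simp_all add: linear_add linear_diff linear_cmul algebra_simps inner_add_right)
    moreover have "inj H"
    proof (subst linear_injective_0[OF \<open>linear H\<close>], intro allI impI)
      fix w assume "H w = 0"
      then have w: "\<omega> \<bullet> w = 0" using H\<omega>[of w] by simp
      then have "P' \<omega> w = 0" using \<open>H w = 0\<close> by (simp add: H_def)
      then show "w = 0"
        using gauss_map_differential_P'[OF D \<omega> w] D has_derivative_linear linear_0
        unfolding gauss_map_differential_def by metis
    qed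
    ultimately have "surj H" by (rule linear_inj_imp_surj)
    then obtain w where Hw: "H w = v" by (metis surjD)
    then have w: "\<omega> \<bullet> w = 0" using H\<omega>[of w] v by simp
    then have "P' \<omega> w = v" using Hw by (simp add: H_def)
    then have wv: "w = k *\<^sub>R v" using gauss_map_differential_P'[OF E(1) \<omega> w] E(2) by simp
    then have "v = k *\<^sub>R P' \<omega> v"
      using \<open>P' \<omega> w = v\<close> linear_P'[OF \<omega>] by (simp add: linear_cmul)
    \<comment> \<open>Here \<open>k\<close> is nonzero, since otherwise
      \<open>v = k *\<^sub>R P' \<omega> v\<close> would be zero.\<close>
    then have "P' \<omega> v = inverse k *\<^sub>R v"
      using \<open>v \<noteq> 0\<close> by (metis real_vector.scale_zero_left scaleR_one scaleR_scaleR left_inverse)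
    then show ?thesis by blast
  qed
  moreover have "\<exists>k. D v = k *\<^sub>R v" if v: "\<omega> \<bullet> v = 0" "v \<noteq> 0" and r: "P' \<omega> v = r *\<^sub>R v" for r
  proof -
    have "v = r *\<^sub>R D v"
      using gauss_map_differential_P'[OF D \<omega> v(1)] r D has_derivative_linear linear_cmul
      unfolding gauss_map_differential_def by metis
    then have "D v = inverse r *\<^sub>R v"
      using v by (metis real_vector.scale_zero_left scaleR_one scaleR_scaleR left_inverse)
    then show ?thesis by blast
  qed
  ultimately show ?thesis
    unfolding principal_direction_def T using D by blast
qed

end

section \<open>Spherical coordinates and rotations about the axis\<close>

text \<open>A nonzero remainder would be orthogonal to \<open>a\<close>, \<open>b\<close> and
  \<open>c\<close>, giving four independent vectors in dimension three.\<close>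

lemma orthonormal_expansion:
  fixes a b c x :: "real^3"
  assumes "norm a = 1" "norm b = 1" "norm c = 1" "a \<bullet> b = 0" "a \<bullet> c = 0" "b \<bullet> c = 0"
  shows "x = (x \<bullet> a) *\<^sub>R a + (x \<bullet> b) *\<^sub>R b + (x \<bullet> c) *\<^sub>R c"
proof (rule ccontr)
  define y where "y = x - ((x \<bullet> a) *\<^sub>R a + (x \<bullet> b) *\<^sub>R b + (x \<bullet> c) *\<^sub>R c)"
  assume "\<not> ?thesis"
  then have "y \<noteq> 0" by (simp add: y_def)
  have 1: "a \<bullet> a = 1" "b \<bullet> b = 1" "c \<bullet> c = 1" using assms by (auto simp: norm_eq_1)
  have 0: "b \<bullet> a = 0" "c \<bullet> a = 0" "c \<bullet> b = 0" using assms by (auto simp: inner_commute)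
  have y: "y \<bullet> a = 0" "y \<bullet> b = 0" "y \<bullet> c = 0"
    using assms 0 1 by (auto simp: y_def inner_diff inner_add)
  then have y': "a \<bullet> y = 0" "b \<bullet> y = 0" "c \<bullet> y = 0" by (auto simp: inner_commute)
  have "pairwise orthogonal {a, b, c, y}"
    using assms 0 y y' by (auto simp: pairwise_def orthogonal_def)
  moreover have "0 \<notin> {a, b, c, y}" using \<open>y \<noteq> 0\<close> assms by auto
  ultimately have "independent {a, b, c, y}" by (rule pairwise_orthogonal_independent)
  then have "card {a, b, c, y} \<le> 3" using independent_bound by fastforce
  moreover have "card {a, b, c, y} = 4"
  proof -
    have "a \<noteq> b" "a \<noteq> c" "b \<noteq> c" "a \<noteq> y" "b \<noteq> y" "c \<noteq> y"
      using assms 1 y \<open>y \<noteq> 0\<close> by auto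
    then show ?thesis by simp
  qed
  ultimately show False by simp
qed

lemma orthogonal_transformation_reflection:
  fixes e :: "'a::euclidean_space"
  assumes "norm e = 1"
  shows "orthogonal_transformation (\<lambda>x. x - (2 * (x \<bullet> e)) *\<^sub>R e)"
proof -
  have "e \<bullet> e = 1" using assms by (simp add: norm_eq_1)
  then show ?thesis
    unfolding orthogonal_transformation_def
    by (auto intro!: linearI simp: algebra_simps inner_diff inner_add inner_commute)
qed

locale orthonormal_frame =
  fixes v1 v2 \<nu> :: "real^3"
  assumes norms: "norm v1 = 1" "norm v2 = 1" "norm \<nu> = 1"
    and orth: "v1 \<bullet> v2 = 0" "v1 \<bullet> \<nu> = 0" "v2 \<bullet> \<nu> = 0"
begin

lemma inner_frame [simp]:
  "v1 \<bullet> v1 = 1" "v2 \<bullet> v2 = 1" "\<nu> \<bullet> \<nu> = 1" "v1 \<bullet> v2 = 0" "v2 \<bullet> v1 = 0"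
  "v1 \<bullet> \<nu> = 0" "\<nu> \<bullet> v1 = 0" "v2 \<bullet> \<nu> = 0" "\<nu> \<bullet> v2 = 0"
  using norms orth by (auto simp: norm_eq_1 inner_commute)

lemma expansion: "x = (x \<bullet> v1) *\<^sub>R v1 + (x \<bullet> v2) *\<^sub>R v2 + (x \<bullet> \<nu>) *\<^sub>R \<nu>"
  by (rule orthonormal_expansion) (use norms orth in auto)

abbreviation U where "U \<equiv> u v1 v2"
abbreviation E where "E \<equiv> u_perp v1 v2"

lemma E_eq: "E \<theta> = - sin \<theta> *\<^sub>R v1 + cos \<theta> *\<^sub>R v2"
  unfolding u_perp_def u_def
  by (rule vector_derivative_at great_circle_has_vector_derivative)+

lemma U_deriv: "(U has_vector_derivative E \<theta>) (at \<theta>)"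
  unfolding E_eq using great_circle_has_vector_derivative[of v1 v2 \<theta>] by (simp add: u_def[abs_def])

lemma inner_U [simp]:
  "U \<theta> \<bullet> U \<theta> = 1" "U \<theta> \<bullet> E \<theta> = 0" "E \<theta> \<bullet> U \<theta> = 0" "E \<theta> \<bullet> E \<theta> = 1"
  "U \<theta> \<bullet> \<nu> = 0" "E \<theta> \<bullet> \<nu> = 0" "\<nu> \<bullet> U \<theta> = 0" "\<nu> \<bullet> E \<theta> = 0"
proof -
  have *: "sin \<theta> * sin \<theta> + cos \<theta> * cos \<theta> = 1" "cos \<theta> * cos \<theta> + sin \<theta> * sin \<theta> = 1"
    using sin_cos_squared_add[of \<theta>] by (auto simp: power2_eq_square)
  show "U \<theta> \<bullet> U \<theta> = 1" "U \<theta> \<bullet> E \<theta> = 0" "E \<theta> \<bullet> U \<theta> = 0" "E \<theta> \<bullet> E \<theta> = 1"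
    "U \<theta> \<bullet> \<nu> = 0" "E \<theta> \<bullet> \<nu> = 0" "\<nu> \<bullet> U \<theta> = 0" "\<nu> \<bullet> E \<theta> = 0"
    using * by (simp_all add: u_def E_eq inner_add inner_diff)
qed

lemma norm_U [simp]: "norm (U \<theta>) = 1" "norm (E \<theta>) = 1" "norm \<nu> = 1"
  by (simp_all add: norm_eq_1)

definition sph :: "real \<Rightarrow> real \<Rightarrow> real^3"
  where "sph \<alpha> \<theta> = sin \<alpha> *\<^sub>R U \<theta> + cos \<alpha> *\<^sub>R \<nu>"

abbreviation T where "T \<equiv> tau \<nu> v1 v2"

lemma norm_sph [simp]: "norm (sph \<alpha> \<theta>) = 1"
  using great_circle_mem_sphere[of \<nu> "U \<theta>" \<alpha>] by (simp add: sph_def add.commute)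

lemma inner_sph [simp]:
  "sph \<alpha> \<theta> \<bullet> \<nu> = cos \<alpha>" "sph \<alpha> \<theta> \<bullet> E \<theta> = 0" "sph \<alpha> \<theta> \<bullet> T \<alpha> \<theta> = 0"
  "E \<theta> \<bullet> T \<alpha> \<theta> = 0" "T \<alpha> \<theta> \<bullet> E \<theta> = 0" "T \<alpha> \<theta> \<bullet> T \<alpha> \<theta> = 1"
proof -
  have *: "sin \<alpha> * sin \<alpha> + cos \<alpha> * cos \<alpha> = 1"
    using sin_cos_squared_add[of \<alpha>] by (auto simp: power2_eq_square)
  then show "sph \<alpha> \<theta> \<bullet> \<nu> = cos \<alpha>" "sph \<alpha> \<theta> \<bullet> E \<theta> = 0" "sph \<alpha> \<theta> \<bullet> T \<alpha> \<theta> = 0"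
    "E \<theta> \<bullet> T \<alpha> \<theta> = 0" "T \<alpha> \<theta> \<bullet> E \<theta> = 0" "T \<alpha> \<theta> \<bullet> T \<alpha> \<theta> = 1"
    by (simp_all add: sph_def tau_def inner_add inner_diff)
qed

lemma norm_T [simp]: "norm (T \<alpha> \<theta>) = 1"
  by (simp add: norm_eq_1)

text \<open>The sign is negative because increasing \<alpha> leads away from the pole \<nu>, while
  \<open>T\<close> points towards it.\<close>

lemma sph_deriv_\<alpha>: "((\<lambda>\<alpha>. sph \<alpha> \<theta>) has_vector_derivative - T \<alpha> \<theta>) (at \<alpha>)"
  using great_circle_has_vector_derivative[of \<nu> "U \<theta>" \<alpha>]
  by (simp add: sph_def tau_def add.commute)

lemma sph_deriv_\<theta>: "(sph \<alpha> has_vector_derivative sin \<alpha> *\<^sub>R E \<theta>) (at \<theta>)"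
  unfolding sph_def[abs_def] by (auto intro!: derivative_eq_intros U_deriv)

lemma sphere_sph:
  assumes "norm \<omega> = 1"
  obtains \<alpha> \<theta> where "0 \<le> \<alpha>" "\<alpha> \<le> pi" "\<omega> = sph \<alpha> \<theta>"
proof -
  define \<alpha> where "\<alpha> = arccos (\<omega> \<bullet> \<nu>)"
  have "\<bar>\<omega> \<bullet> \<nu>\<bar> \<le> 1" using Cauchy_Schwarz_ineq2[of \<omega> \<nu>] assms by simp
  then have \<alpha>: "0 \<le> \<alpha>" "\<alpha> \<le> pi" "cos \<alpha> = \<omega> \<bullet> \<nu>"
    by (auto simp: \<alpha>_def arccos_lbound arccos_ubound cos_arccos_abs)
  define p where "p = (\<omega> \<bullet> v1)"
  define q where "q = (\<omega> \<bullet> v2)"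
  have \<omega>: "\<omega> = p *\<^sub>R v1 + q *\<^sub>R v2 + cos \<alpha> *\<^sub>R \<nu>" using expansion[of \<omega>] by (simp add: \<alpha> p_def q_def)
  have "1 = \<omega> \<bullet> \<omega>" using assms by (simp add: norm_eq_1)
  also have "\<dots> = p\<^sup>2 + q\<^sup>2 + (cos \<alpha>)\<^sup>2" by (subst (1 2) \<omega>) (simp add: inner_add power2_eq_square)
  finally have pq: "p\<^sup>2 + q\<^sup>2 = (sin \<alpha>)\<^sup>2" using sin_cos_squared_add[of \<alpha>] by linarith
  have "\<exists>\<theta>. p = sin \<alpha> * cos \<theta> \<and> q = sin \<alpha> * sin \<theta>"
  proof (cases "sin \<alpha> = 0")
    case True
    \<comment> \<open>At a pole both \<open>p\<close> and \<open>q\<close> vanish, and any longitude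
      works.\<close>
    then show ?thesis using pq by simp
  next
    case False
    then have "(p / sin \<alpha>)\<^sup>2 + (q / sin \<alpha>)\<^sup>2 = 1"
      using pq by (simp add: power_divide add_divide_distrib[symmetric])
    then obtain \<theta> where "p / sin \<alpha> = cos \<theta>" "q / sin \<alpha> = sin \<theta>"
      using sincos_total_2pi by metis
    then show ?thesis using False by (auto simp: field_simps)
  qed
  then obtain \<theta> where "p = sin \<alpha> * cos \<theta>" "q = sin \<alpha> * sin \<theta>" by blast
  then have "\<omega> = sph \<alpha> \<theta>" using \<omega> by (simp add: sph_def u_def algebra_simps)
  then show thesis using that \<alpha> by blast
qed

text \<open>The rotation by \<theta> about the axis, written through the images
  \<open>U \<theta>\<close>, \<open>E \<theta>\<close>, \<nu> of the frame vectors.\<close>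

definition rot :: "real \<Rightarrow> real^3 \<Rightarrow> real^3"
  where "rot \<theta> x = (x \<bullet> v1) *\<^sub>R U \<theta> + (x \<bullet> v2) *\<^sub>R E \<theta> + (x \<bullet> \<nu>) *\<^sub>R \<nu>"

lemma linear_rot: "linear (rot \<theta>)"
  by (auto intro!: linearI simp: rot_def algebra_simps inner_add)

lemma orthogonal_rot: "orthogonal_transformation (rot \<theta>)"
proof -
  have "rot \<theta> x \<bullet> rot \<theta> y = x \<bullet> y" for x y
  proof -
    have "rot \<theta> x \<bullet> rot \<theta> y = (x \<bullet> v1) * (y \<bullet> v1) + (x \<bullet> v2) * (y \<bullet> v2) + (x \<bullet> \<nu>) * (y \<bullet> \<nu>)"
      by (simp add: rot_def inner_add)
    also have "\<dots> = x \<bullet> y"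
      by (subst (3) expansion[of y]) (simp add: inner_add_right mult.commute)
    finally show ?thesis .
  qed
  then show ?thesis using linear_rot by (simp add: orthogonal_transformation_def)
qed

lemma rot_axis: "rot \<theta> \<nu> = \<nu>"
  by (simp add: rot_def)

lemma rot_rot: "rot s (rot t x) = rot (s + t) x"
  by (simp add: rot_def u_def E_eq inner_add sin_add cos_add algebra_simps)

lemma rot_sph: "rot s (sph \<alpha> t) = sph \<alpha> (s + t)"
  by (simp add: rot_def sph_def u_def E_eq inner_add sin_add cos_add algebra_simps)

text \<open>Half angles give determinant \<open>1\<close> without computing it.\<close>

lemma rotation_matrix_rot: "rotation_matrix (matrix (rot \<theta>))"
proof -
  have orth: "orthogonal_matrix (matrix (rot s))" for s
    using orthogonal_rot orthogonal_transformation_matrix by blast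
  have "rot \<theta> = rot (\<theta> / 2) \<circ> rot (\<theta> / 2)" by (auto simp: rot_rot)
  then have "det (matrix (rot \<theta>)) = det (matrix (rot (\<theta> / 2))) * det (matrix (rot (\<theta> / 2)))"
    using matrix_compose[OF linear_rot linear_rot] det_mul by metis
  also have "\<dots> = 1" using det_orthogonal_matrix[OF orth[of "\<theta> / 2"]] by auto
  finally show ?thesis using orth by (simp add: rotation_matrix_def)
qed

lemma rotation_about_axis_rot: "rotation_about_axis p \<nu> (\<lambda>x. p + rot \<theta> (x - p))"
proof -
  have "matrix (rot \<theta>) *v x = rot \<theta> x" for x by (simp add: matrix_works linear_rot)
  then show ?thesis
    unfolding rotation_about_axis_def using rotation_matrix_rot rot_axis
    by (intro exI[of _ "matrix (rot \<theta>)"]) auto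
qed

end

section \<open>Symmetries of the body\<close>

text \<open>Since \<open>T\<close> preserves inner products and the height along \<nu>, the gap
  \<open>support_function K \<zeta> - x \<bullet> \<zeta>\<close> is unchanged when \<open>x\<close>
  and \<zeta> are replaced by \<open>a + T (x - a)\<close> and \<open>T \<zeta>\<close>. Nonnegative
  gaps express membership, and a zero gap expresses being a support point.\<close>

lemma orthogonal_symmetry_of_support:
  assumes K: "convex_body K" and T: "orthogonal_transformation T" "T \<nu> = \<nu>"
    and h: "\<forall>\<omega>\<in>sphere 0 1. support_function K \<omega> = \<phi> (\<omega> \<bullet> \<nu>) + a \<bullet> \<omega>"
    and x: "x \<in> K"
  shows "a + T (x - a) \<in> K"
    and "norm \<omega> = 1 \<Longrightarrow> x \<bullet> \<omega> = support_function K \<omega> \<Longrightarrow>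
      (a + T (x - a)) \<bullet> T \<omega> = support_function K (T \<omega>)"
proof -
  have TT: "T v \<bullet> T w = v \<bullet> w" for v w using T by (simp add: orthogonal_transformation_def)
  have T\<nu>: "T \<zeta> \<bullet> \<nu> = \<zeta> \<bullet> \<nu>" for \<zeta> using TT[of \<zeta> \<nu>] T by simp
  have norm: "norm (T \<zeta>) = norm \<zeta>" for \<zeta> using T orthogonal_transformation_norm by blast
  have eq: "support_function K (T \<zeta>) - (a + T (x - a)) \<bullet> T \<zeta> = support_function K \<zeta> - x \<bullet> \<zeta>"
    if "norm \<zeta> = 1" for \<zeta>
    using h that by (simp add: norm T\<nu> inner_add_left TT inner_diff_left)
  show "(a + T (x - a)) \<bullet> T \<omega> = support_function K (T \<omega>)"
    if "norm \<omega> = 1" "x \<bullet> \<omega> = support_function K \<omega>"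
    using eq[of \<omega>] that by simp
  show "a + T (x - a) \<in> K"
    unfolding mem_convex_body_iff[OF K]
  proof
    fix \<eta> :: "real^3" assume "\<eta> \<in> sphere 0 1"
    moreover obtain \<zeta> where "\<eta> = T \<zeta>"
      using T orthogonal_transformation_surj by (metis surjD)
    ultimately have "norm \<zeta> = 1" "\<eta> = T \<zeta>" using norm by auto
    then show "(a + T (x - a)) \<bullet> \<eta> \<le> support_function K \<eta>"
      using eq[of \<zeta>] inner_le_support_function[OF K x, of \<zeta>] by simp
  qed
qed

section \<open>The implications between the three statements\<close>

locale framed_support_points = support_points K P P' + orthonormal_frame v1 v2 \<nu>
  for K P P' v1 v2 \<nu> +
  assumes gauss_differentiable: "p \<in> frontier K \<Longrightarrow> \<exists>D. gauss_map_differential K p D"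
begin

lemma principal_iff:
  assumes "norm \<omega> = 1"
  shows "principal_direction K (inv_into (frontier K) (gauss_map K) \<omega>) v \<longleftrightarrow>
    \<omega> \<bullet> v = 0 \<and> v \<noteq> 0 \<and> (\<exists>r. P' \<omega> v = r *\<^sub>R v)"
  using principal_direction_iff gauss_differentiable[OF P_frontier] inv_gauss_map assms by metis

lemma support_function_of_principal_directions:
  assumes S1: "\<And>\<alpha> \<theta>. 0 < \<alpha> \<Longrightarrow> \<alpha> < pi \<Longrightarrow>
    principal_direction K (inv_into (frontier K) (gauss_map K) (sph \<alpha> \<theta>)) (T \<alpha> \<theta>)"
  shows "\<exists>\<phi> a. \<forall>\<omega>\<in>sphere 0 1. support_function K \<omega> = \<phi> (\<omega> \<bullet> \<nu>) + a \<bullet> \<omega>"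
proof -
  define a where "a = P \<nu>"
  have meridian: "P (sph \<alpha> \<theta>) \<bullet> E \<theta> = a \<bullet> E \<theta>" if "0 \<le> \<alpha>" "\<alpha> \<le> pi" for \<alpha> \<theta>
  proof -
    define q where "q \<alpha> = P (sph \<alpha> \<theta>) \<bullet> E \<theta>" for \<alpha>
    have dq: "(q has_real_derivative P' (sph \<alpha> \<theta>) (- T \<alpha> \<theta>) \<bullet> E \<theta>) (at \<alpha>)" for \<alpha>
      unfolding has_real_derivative_iff_has_vector_derivative q_def[abs_def]
      by (intro bounded_linear.has_vector_derivative[OF bounded_linear_inner_left]
          P_along_curve[OF sph_deriv_\<alpha>] norm_sph)
    have "(q has_real_derivative 0) (at \<alpha>)" if \<alpha>: "0 < \<alpha>" "\<alpha> < pi" for \<alpha>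
    proof -
      obtain r where "P' (sph \<alpha> \<theta>) (T \<alpha> \<theta>) = r *\<^sub>R T \<alpha> \<theta>"
        using S1[OF \<alpha>] principal_iff[OF norm_sph] by blast
      then show ?thesis
        using dq[of \<alpha>] linear_P'[OF norm_sph] by (simp add: linear_neg)
    qed
    \<comment> \<open>The frame condition is available only strictly between the poles; continuity
      carries constancy to the endpoints, and \<open>q 0\<close> is the value at \<nu>.\<close>
    moreover have "continuous_on {0..pi} q"
      using dq by (intro DERIV_continuous_on) (auto intro: has_field_derivative_at_within)
    ultimately have "q \<alpha> = q 0"
      using that by (intro DERIV_isconst2[OF pi_gt_zero])
    then show ?thesis by (simp add: q_def a_def sph_def)
  qed
  have parallel: "support_function K (sph \<alpha> \<theta>) - a \<bullet> sph \<alpha> \<theta> =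
      support_function K (sph \<alpha> 0) - a \<bullet> sph \<alpha> 0" if \<alpha>: "0 \<le> \<alpha>" "\<alpha> \<le> pi" for \<alpha> \<theta>
  proof -
    have "((\<lambda>s. support_function K (sph \<alpha> s) - a \<bullet> sph \<alpha> s) has_real_derivative
        P (sph \<alpha> s) \<bullet> (sin \<alpha> *\<^sub>R E s) - a \<bullet> (sin \<alpha> *\<^sub>R E s)) (at s)" for s
      by (intro DERIV_diff support_function_along_curve sph_deriv_\<theta>)
        (auto simp: has_real_derivative_iff_has_vector_derivative
          intro!: bounded_linear.has_vector_derivative[OF bounded_linear_inner_right sph_deriv_\<theta>, simplified])
    then have "\<forall>s. ((\<lambda>s. support_function K (sph \<alpha> s) - a \<bullet> sph \<alpha> s) has_real_derivative 0) (at s)"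
      using meridian[OF \<alpha>] by simp
    then show ?thesis by (rule DERIV_isconst_all)
  qed
  \<comment> \<open>The profile is read off on the meridian of longitude 0; \<open>arccos\<close>
    recovers the colatitude from the height, as \<alpha> ranges over \<open>{0..pi}\<close>.\<close>
  define \<phi> where "\<phi> s = support_function K (sph (arccos s) 0) - a \<bullet> sph (arccos s) 0" for s
  have "support_function K \<omega> = \<phi> (\<omega> \<bullet> \<nu>) + a \<bullet> \<omega>" if \<omega>: "\<omega> \<in> sphere 0 1" for \<omega>
  proof -
    obtain \<alpha> \<theta> where "0 \<le> \<alpha>" "\<alpha> \<le> pi" "\<omega> = sph \<alpha> \<theta>" using sphere_sph[of \<omega>] \<omega> by auto
    then show ?thesis using parallel[of \<alpha> \<theta>] by (simp add: \<phi>_def arccos_cos)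
  qed
  then show ?thesis by blast
qed

text \<open>The reflection in the plane spanned by \<open>\<nu>\<close> and \<open>\<omega>\<close> is a symmetry of \<open>K\<close>,
  so it commutes with the derivative of \<open>P\<close> at \<open>\<omega>\<close>.\<close>

lemma principal_directions_of_support_function:
  assumes h: "\<forall>\<omega>\<in>sphere 0 1. support_function K \<omega> = \<phi> (\<omega> \<bullet> \<nu>) + a \<bullet> \<omega>"
  shows "principal_direction K (inv_into (frontier K) (gauss_map K) (sph \<alpha> \<theta>)) (E \<theta>)"
    and "principal_direction K (inv_into (frontier K) (gauss_map K) (sph \<alpha> \<theta>)) (T \<alpha> \<theta>)"
proof -
  define \<omega> where "\<omega> = sph \<alpha> \<theta>"
  define e where "e = E \<theta>"
  define t where "t = T \<alpha> \<theta>"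
  have n: "norm \<omega> = 1" "norm e = 1" "norm t = 1" by (simp_all add: \<omega>_def e_def t_def)
  then have "e \<noteq> 0" "t \<noteq> 0" by auto
  have ip: "\<omega> \<bullet> e = 0" "\<omega> \<bullet> t = 0" "e \<bullet> t = 0" "t \<bullet> e = 0" "e \<bullet> e = 1"
    by (simp_all add: \<omega>_def e_def t_def)
  define R where "R x = x - (2 * (x \<bullet> e)) *\<^sub>R e" for x
  have R: "orthogonal_transformation R"
    unfolding R_def[abs_def] by (rule orthogonal_transformation_reflection[OF n(2)])
  have "R \<nu> = \<nu>" by (simp add: R_def e_def)
  note sym = orthogonal_symmetry_of_support[OF body R this h]
  have normR: "norm (R v) = norm v" for v using R orthogonal_transformation_norm by blast
  \<comment> \<open>The reflected point is a support point at \<open>R v\<close>, so uniqueness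
    makes \<open>P\<close> equivariant under the reflection.\<close>
  have PR: "P (R v) = a + R (P v - a)" if "norm v = 1" for v
    using P_iff[of "R v" "a + R (P v - a)"] sym(1)[OF P_mem] sym(2)[OF P_mem] P_inner that normR by simp
  have "P' \<omega> t \<bullet> e = 0"
  proof -
    define c where "c = (\<lambda>s. cos s *\<^sub>R \<omega> + sin s *\<^sub>R t)"
    have c: "norm (c s) = 1" for s using great_circle_mem_sphere n ip by (simp add: c_def)
    \<comment> \<open>This great circle lies in the mirror plane, so \<open>P (c s) - a\<close> lies
      there too and its \<open>e\<close>-component is constantly zero.\<close>
    have "R (c s) = c s" for s using ip by (simp add: R_def c_def inner_add_left)
    then have "P (c s) = a + R (P (c s) - a)" for s using PR[OF c] by metis
    then have "(2 * ((P (c s) - a) \<bullet> e)) *\<^sub>R e = 0" for s by (simp add: R_def algebra_simps)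
    then have "P (c s) \<bullet> e = a \<bullet> e" for s using \<open>e \<noteq> 0\<close> by (simp add: inner_diff_left)
    moreover have "((\<lambda>s. P (c s) \<bullet> e) has_real_derivative P' \<omega> t \<bullet> e) (at 0)"
      unfolding c_def using P_along_great_circle(2) n ip by blast
    ultimately show ?thesis using DERIV_unique[OF _ DERIV_const] by simp
  qed
  moreover have "P' \<omega> e \<bullet> t = 0"
  proof -
    define c where "c = (\<lambda>s. cos s *\<^sub>R \<omega> + sin s *\<^sub>R e)"
    have c: "norm (c s) = 1" for s using great_circle_mem_sphere n ip by (simp add: c_def)
    \<comment> \<open>This great circle crosses the mirror plane orthogonally and is reversed by
      \<open>R\<close>. As \<open>R\<close> preserves \<open>t\<close>-components,
      \<open>P (c s) \<bullet> t\<close> is an even function of \<open>s\<close>, with derivative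
      zero at 0.\<close>
    have "c (- s) = R (c s)" for s
    proof -
      have "c s \<bullet> e = sin s" using ip by (simp add: c_def inner_add_left)
      then have "R (c s) = c s - (sin s *\<^sub>R e + sin s *\<^sub>R e)"
        unfolding R_def scaleR_left_distrib[symmetric] by simp
      then show ?thesis by (simp add: c_def)
    qed
    then have "P (c (- s)) = a + R (P (c s) - a)" for s using PR[OF c] by metis
    moreover have "R x \<bullet> t = x \<bullet> t" for x using ip by (simp add: R_def inner_diff_left)
    ultimately have even: "P (c (- s)) \<bullet> t = P (c s) \<bullet> t" for s by (simp add: inner_add_left inner_diff_left)
    have d: "((\<lambda>s. P (c s) \<bullet> t) has_real_derivative P' \<omega> e \<bullet> t) (at 0)"
      unfolding c_def using P_along_great_circle(2) n ip by blast
    then have "((\<lambda>s. P (c (- s)) \<bullet> t) has_real_derivative - (P' \<omega> e \<bullet> t)) (at 0)"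
      using DERIV_mirror[of "\<lambda>s. P (c s) \<bullet> t" "P' \<omega> e \<bullet> t" 0] by simp
    then have "- (P' \<omega> e \<bullet> t) = P' \<omega> e \<bullet> t" unfolding even using d by (rule DERIV_unique)
    then show ?thesis by simp
  qed
  moreover have "P' \<omega> e \<bullet> \<omega> = 0" "P' \<omega> t \<bullet> \<omega> = 0"
    using P'_tangent n ip by auto
  ultimately have "P' \<omega> e = (P' \<omega> e \<bullet> e) *\<^sub>R e" "P' \<omega> t = (P' \<omega> t \<bullet> t) *\<^sub>R t"
    using orthonormal_expansion[of \<omega> e t "P' \<omega> e"] orthonormal_expansion[of \<omega> e t "P' \<omega> t"] n ip by auto
  then show
    "principal_direction K (inv_into (frontier K) (gauss_map K) (sph \<alpha> \<theta>)) (E \<theta>)"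
    "principal_direction K (inv_into (frontier K) (gauss_map K) (sph \<alpha> \<theta>)) (T \<alpha> \<theta>)"
    using principal_iff[OF norm_sph] ip \<open>e \<noteq> 0\<close> \<open>t \<noteq> 0\<close> unfolding \<omega>_def e_def t_def by blast+
qed

text \<open>From (2) to (3): translating by \<open>- a\<close> moves the centre of the symmetries to
  the origin, where rotations fixing \<nu> are among the orthogonal maps already treated.\<close>

lemma body_of_revolution_of_support_function:
  assumes h: "\<forall>\<omega>\<in>sphere 0 1. support_function K \<omega> = \<phi> (\<omega> \<bullet> \<nu>) + a \<bullet> \<omega>"
  shows "body_of_revolution ((\<lambda>x. x + - a) ` K) 0 \<nu>"
proof -
  let ?L = "(\<lambda>x. x + - a) ` K"
  have L: "?L = (+) (- a) ` K" by (auto simp: add.commute)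
  have "convex_body ?L"
    using body convex_translation compact_translation
    unfolding convex_body_def L interior_translation by (metis image_is_empty)
  moreover have "f ` ?L = ?L" if f: "rotation_about_axis 0 \<nu> f" for f
  proof -
    obtain Q :: "real^3^3" where Q: "orthogonal_matrix Q" "Q *v \<nu> = \<nu>" "f = (*v) Q"
      using f by (auto simp: rotation_about_axis_def rotation_matrix_def)
    have sub: "(\<lambda>x. A *v x) ` ?L \<subseteq> ?L" if "orthogonal_matrix A" "A *v \<nu> = \<nu>" for A :: "real^3^3"
    proof -
      have "orthogonal_transformation ((*v) A)"
        using that by (simp add: orthogonal_transformation_matrix)
      from orthogonal_symmetry_of_support(1)[OF body this that(2) h]
      show ?thesis by (force simp: image_iff)
    qed
    \<comment> \<open>\<open>sub\<close> yields inclusions only; applying it to the inverse rotation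
      as well turns the inclusion for \<open>Q\<close> into equality.\<close>
    have QT: "transpose Q ** Q = mat 1" "Q ** transpose Q = mat 1"
      using Q by (auto simp: orthogonal_matrix_def)
    then have "transpose Q *v \<nu> = \<nu>"
      using Q by (metis matrix_vector_mul_assoc matrix_vector_mul_lid)
    then have "(\<lambda>x. transpose Q *v x) ` ?L \<subseteq> ?L"
      using sub[of "transpose Q"] Q orthogonal_matrix_transpose by blast
    then have "(\<lambda>x. Q *v x) ` (\<lambda>x. transpose Q *v x) ` ?L \<subseteq> (\<lambda>x. Q *v x) ` ?L"
      by (rule image_mono)
    then have "?L \<subseteq> (\<lambda>x. Q *v x) ` ?L"
      unfolding image_image matrix_vector_mul_assoc QT by simp
    then show ?thesis using sub Q by blast
  qed
  ultimately show ?thesis by (simp add: body_of_revolution_def)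
qed

text \<open>From (3) to (2): the axis of \<open>K\<close> itself passes through
  \<open>b = p - s\<close>. The function \<open>g\<close> is the support function of
  \<open>K\<close> translated by \<open>- b\<close>; being invariant under rotations about \<nu>, it
  depends on the colatitude alone.\<close>

lemma support_function_of_body_of_revolution:
  assumes rev: "body_of_revolution ((\<lambda>x. x + s) ` K) p \<nu>"
  shows "\<exists>\<phi> a. \<forall>\<omega>\<in>sphere 0 1. support_function K \<omega> = \<phi> (\<omega> \<bullet> \<nu>) + a \<bullet> \<omega>"
proof -
  define b where "b = p - s"
  have inv: "b + rot \<theta> (x - b) \<in> K" if "x \<in> K" for x \<theta>
  proof -
    have "(\<lambda>x. p + rot \<theta> (x - p)) ` (\<lambda>x. x + s) ` K = (\<lambda>x. x + s) ` K"
      using rev rotation_about_axis_rot by (simp add: body_of_revolution_def)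
    then have "p + rot \<theta> (x + s - p) \<in> (\<lambda>x. x + s) ` K" using that by blast
    then obtain y where "y \<in> K" "p + rot \<theta> (x + s - p) = y + s" by blast
    moreover from this have "b + rot \<theta> (x - b) = y"
      by (simp add: b_def algebra_simps)
    ultimately show ?thesis by simp
  qed
  define g where "g \<omega> = support_function K \<omega> - b \<bullet> \<omega>" for \<omega>
  have le: "g \<omega> \<le> g (rot \<theta> \<omega>)" for \<omega> \<theta>
  proof -
    obtain x where x: "x \<in> K" "x \<bullet> \<omega> = support_function K \<omega>"
      using support_function_attained[OF body] .
    have "rot \<theta> (x - b) \<bullet> rot \<theta> \<omega> = (x - b) \<bullet> \<omega>"
      using orthogonal_rot by (simp add: orthogonal_transformation_def)
    then have "g \<omega> = (b + rot \<theta> (x - b)) \<bullet> rot \<theta> \<omega> - b \<bullet> rot \<theta> \<omega>"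
      using x by (simp add: g_def inner_add_left inner_diff_left)
    also have "\<dots> \<le> g (rot \<theta> \<omega>)"
      using inner_le_support_function[OF body inv[OF x(1)]] by (simp add: g_def)
    finally show ?thesis .
  qed
  \<comment> \<open>The inequality \<open>le\<close>, used for opposite rotations, gives
    equality.\<close>
  have g: "g (sph \<alpha> \<theta>) = g (sph \<alpha> 0)" for \<alpha> \<theta>
    using le[of "sph \<alpha> \<theta>" "- \<theta>"] le[of "sph \<alpha> 0" \<theta>] by (simp add: rot_sph)
  have "support_function K \<omega> = g (sph (arccos (\<omega> \<bullet> \<nu>)) 0) + b \<bullet> \<omega>" if \<omega>: "\<omega> \<in> sphere 0 1" for \<omega>
  proof -
    obtain \<alpha> \<theta> where "0 \<le> \<alpha>" "\<alpha> \<le> pi" "\<omega> = sph \<alpha> \<theta>" using sphere_sph[of \<omega>] \<omega> by auto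
    then show ?thesis using g[of \<alpha> \<theta>] by (simp add: arccos_cos) (simp add: g_def)
  qed
  then show ?thesis by (intro exI[of _ "\<lambda>s. g (sph (arccos s) 0)"] exI[of _ b]) blast
qed

end

theorem proposition4:
  fixes K :: "(real ^ 3) set" and \<nu> v1 v2 :: "real ^ 3"
  assumes body: "convex_body K"
    and boundary: "C2_boundary K"
    and curvature: "\<forall>p\<in>frontier K. \<exists>k>0. has_gaussian_curvature K p k"
    and support: "C2_on_sphere (support_function K)"
    and axis: "\<nu> \<in> sphere 0 1"
    and basis: "norm v1 = 1" "norm v2 = 1" "v1 \<bullet> v2 = 0" "v1 \<bullet> \<nu> = 0" "v2 \<bullet> \<nu> = 0"
  defines "S1 \<equiv> \<forall>\<omega> \<in> sphere 0 1 - {\<nu>, -\<nu>}. \<forall>\<alpha> \<theta>.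
      0 < \<alpha> \<and> \<alpha> < pi \<and> \<omega> = sin \<alpha> *\<^sub>R u v1 v2 \<theta> + cos \<alpha> *\<^sub>R \<nu> \<longrightarrow>
      principal_direction K (inv_into (frontier K) (gauss_map K) \<omega>) (u_perp v1 v2 \<theta>) \<and>
      principal_direction K (inv_into (frontier K) (gauss_map K) \<omega>) (tau \<nu> v1 v2 \<alpha> \<theta>)"
    and "S2 \<equiv> \<exists>(\<phi> :: real \<Rightarrow> real) (a :: real ^ 3). \<forall>\<omega> \<in> sphere 0 1.
      support_function K \<omega> = \<phi> (\<omega> \<bullet> \<nu>) + a \<bullet> \<omega>"
    and "S3 \<equiv> \<exists>t p. body_of_revolution ((\<lambda>x. x + t) ` K) p \<nu>"
  shows "(S1 \<longleftrightarrow> S2) \<and> (S2 \<longleftrightarrow> S3)"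
proof -
  obtain P P' where P: "\<And>\<omega>. norm \<omega> = 1 \<Longrightarrow> (P has_derivative P' \<omega>) (at \<omega>)"
    "\<And>\<omega> x. norm \<omega> = 1 \<Longrightarrow> x \<in> K \<and> x \<bullet> \<omega> = support_function K \<omega> \<longleftrightarrow> x = P \<omega>"
    using support_point_map_exists[OF body support] by blast
  \<comment> \<open>The curvature hypothesis supplies a differential of the Gauss map at every
    frontier point, as the locale requires.\<close>
  interpret framed_support_points K P P' v1 v2 \<nu>
    using P body boundary basis axis curvature
    by unfold_locales (auto simp: has_gaussian_curvature_def)
  have "S1 \<longleftrightarrow> S2"
  proof
    assume S1
    show S2 unfolding S2_def
    proof (rule support_function_of_principal_directions)
      fix \<alpha> \<theta> :: real assume \<alpha>: "0 < \<alpha>" "\<alpha> < pi"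
      \<comment> \<open>The height \<open>cos \<alpha>\<close> lies strictly between -1 and 1, which
        keeps the point away from both poles so that (1) applies.\<close>
      then have "cos \<alpha> < 1" "- 1 < cos \<alpha>"
        using cos_monotone_0_pi[of 0 \<alpha>] cos_monotone_0_pi[of \<alpha> pi] by auto
      then have "sph \<alpha> \<theta> \<noteq> \<nu>" "sph \<alpha> \<theta> \<noteq> - \<nu>"
        using inner_sph(1)[of \<alpha> \<theta>] by (metis inner_frame(3) inner_minus_left less_irrefl)+
      then have "sph \<alpha> \<theta> \<in> sphere 0 1 - {\<nu>, -\<nu>}" by simp
      with \<open>S1\<close> \<alpha> show "principal_direction K (inv_into (frontier K) (gauss_map K) (sph \<alpha> \<theta>)) (tau \<nu> v1 v2 \<alpha> \<theta>)"
        unfolding S1_def using sph_def by blast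
    qed
  next
    assume S2
    then show S1
      unfolding S1_def S2_def
      using principal_directions_of_support_function sph_def by metis
  qed
  moreover have "S2 \<longleftrightarrow> S3"
    unfolding S2_def S3_def
    using body_of_revolution_of_support_function support_function_of_body_of_revolution by blast
  ultimately show ?thesis by blast
qed

end
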